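(* If $D$ is a clique-acyclic digraph with $\alpha(D)=2$, then $\gamma(D)\le 3$.
   Context: Digraphs are finite and loopless; $E(D)$ is the set of directed edges. A digraph $D$ is clique-acyclic if it has no directed (cyclic) triangle, i.e. no three vertices $u,v,w$ with $(u,v),(v,w),(w,u)\in E(D)$. $\alpha(D)$ is the maximum size of an independent set of $D$, i.e. of a set of vertices with no edge (in either direction) between any two of them. $\gamma(D)$ is the domination number of $D$: the smallest size of a set $U\subseteq V(D)$ such that every vertex $v\in V(D)\setminus U$ has some $u\in U$ with $(u,v)\in E(D)$. *)

theory Defs
  imports "Graph_Theory.Digraph"
begin

text \<open>
  Digraphs are the instances of the locale \<^locale>\<open>digraph\<close>: finite, without loops and without
  parallel arcs.  The edge set \<open>E(D)\<close> is \<^term>\<open>arcs_ends D\<close>, and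
  \<open>u \<rightarrow>\<^bsub>D\<^esub> v\<close> abbreviates \<open>(u, v) \<in> arcs_ends D\<close>.  Pairs of opposite arcs are allowed.
  The definitions below are meant for such digraphs; in particular, as there are no loops, vertices
  lying on a common cyclic triangle are automatically distinct.
\<close>

definition clique_acyclic :: "('a, 'b) pre_digraph \<Rightarrow> bool" where
  "clique_acyclic D \<longleftrightarrow>
    \<not> (\<exists>u\<in>verts D. \<exists>v\<in>verts D. \<exists>w\<in>verts D. u \<rightarrow>\<^bsub>D\<^esub> v \<and> v \<rightarrow>\<^bsub>D\<^esub> w \<and> w \<rightarrow>\<^bsub>D\<^esub> u)"

definition independent_set :: "('a, 'b) pre_digraph \<Rightarrow> 'a set \<Rightarrow> bool" where
  "independent_set D S \<longleftrightarrow> S \<subseteq> verts D \<and> (\<forall>u\<in>S. \<forall>v\<in>S. \<not> u \<rightarrow>\<^bsub>D\<^esub> v)"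

definition independence_number :: "('a, 'b) pre_digraph \<Rightarrow> nat" where
  "independence_number D = Max {card S | S. independent_set D S}"

definition dominating_set :: "('a, 'b) pre_digraph \<Rightarrow> 'a set \<Rightarrow> bool" where
  "dominating_set D U \<longleftrightarrow> U \<subseteq> verts D \<and> (\<forall>v\<in>verts D - U. \<exists>u\<in>U. u \<rightarrow>\<^bsub>D\<^esub> v)"

definition domination_number :: "('a, 'b) pre_digraph \<Rightarrow> nat" where
  "domination_number D = Min {card U | U. dominating_set D U}"

end

theory Submission
  imports Defs
begin

text \<open>
  Choose a vertex \<open>x\<close> of minimum in-degree. If \<open>y \<rightarrow> x\<close> is an arc whose reverse is missing, then
  \<open>N\<^sup>-(y) \<subseteq> N\<^sup>-(x)\<close> is impossible: the inclusion would be proper, as \<open>y \<in> N\<^sup>-(x) - N\<^sup>-(y)\<close>. So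
  some \<open>z \<rightarrow> y\<close> does not dominate \<open>x\<close>, and \<open>x \<rightarrow> z\<close> would close a cyclic triangle; hence \<open>z\<close> is
  non-adjacent to \<open>x\<close> (\<open>min_in_degree_vertex\<close>).

  Consequently the set \<open>K\<close> of non-neighbours of \<open>x\<close> dominates every vertex outside \<open>K \<union> {x}\<close> that \<open>x\<close>
  does not dominate; if \<open>K\<close> is empty, then \<open>x\<close> dominates everything. Since \<open>\<alpha>(D) = 2\<close>, the set \<open>K\<close> is a clique, and the same minimum in-degree argument inside a clique
  yields a single vertex \<open>s\<close> dominating it (\<open>clique_dominated_by_vertex\<close>). Let \<open>y\<close> be an
  in-neighbour of \<open>x\<close> that neither \<open>x\<close> nor \<open>s\<close> dominates. It has an in-neighbour \<open>z \<in> K\<close>, and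
  \<open>s \<rightarrow> z \<rightarrow> y\<close> excludes \<open>y \<rightarrow> s\<close>, so \<open>y\<close> is non-adjacent to \<open>s\<close>. The non-neighbours of \<open>s\<close> form a
  clique as well, so one further vertex \<open>t\<close> dominates all remaining vertices.
\<close>

lemma min_in_degree_vertex:
  assumes "finite V" "V \<noteq> {}"
    and irrefl: "\<forall>v\<in>V. \<not> E v v"
    and acyclic: "\<forall>u\<in>V. \<forall>v\<in>V. \<forall>w\<in>V. E u v \<longrightarrow> E v w \<longrightarrow> \<not> E w u"
  obtains x where "x \<in> V"
    and "\<forall>y\<in>V. E y x \<longrightarrow> \<not> E x y \<longrightarrow> (\<exists>z\<in>V. z \<noteq> x \<and> E z y \<and> \<not> E z x \<and> \<not> E x z)"
proof -
  define N where "N v = {u \<in> V. E u v}" for v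
  obtain x where x: "x \<in> V" and min: "\<And>y. y \<in> V \<Longrightarrow> card (N x) \<le> card (N y)"
    using ex_min_if_finite[of "(\<lambda>v. card (N v)) ` V"] \<open>finite V\<close> \<open>V \<noteq> {}\<close>
    by (auto simp: not_less)
  have "\<exists>z\<in>V. z \<noteq> x \<and> E z y \<and> \<not> E z x \<and> \<not> E x z" if y: "y \<in> V" "E y x" "\<not> E x y" for y
  proof -
    have "\<not> N y \<subseteq> N x"
    proof
      assume "N y \<subseteq> N x"
      moreover have "y \<in> N x" "y \<notin> N y" using y irrefl by (auto simp: N_def)
      ultimately have "card (N y) < card (N x)"
        using \<open>finite V\<close> by (intro psubset_card_mono) (auto simp: N_def)
      with min[OF y(1)] show False by simp
    qed
    then obtain z where z: "z \<in> V" "E z y" "\<not> E z x" by (auto simp: N_def)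
    moreover have "z \<noteq> x" using z y by auto
    moreover have "\<not> E x z" using x y z acyclic by blast
    ultimately show ?thesis by blast
  qed
  with x that show ?thesis by blast
qed

text \<open>In a clique every in-neighbour of the vertex of minimum in-degree is also an out-neighbour,
  since that vertex has no non-neighbour. For empty \<open>K\<close> the vertex \<open>s\<close> is arbitrary.\<close>

lemma clique_dominated_by_vertex:
  assumes "finite K"
    and irrefl: "\<forall>v\<in>K. \<not> E v v"
    and acyclic: "\<forall>u\<in>K. \<forall>v\<in>K. \<forall>w\<in>K. E u v \<longrightarrow> E v w \<longrightarrow> \<not> E w u"
    and clique: "\<forall>u\<in>K. \<forall>v\<in>K. u \<noteq> v \<longrightarrow> E u v \<or> E v u"
  obtains s where "K \<noteq> {} \<longrightarrow> s \<in> K" and "\<forall>v\<in>K. v = s \<or> E s v"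
proof (cases "K = {}")
  case True
  with that show ?thesis by blast
next
  case False
  obtain s where "s \<in> K"
    "\<forall>y\<in>K. E y s \<longrightarrow> \<not> E s y \<longrightarrow> (\<exists>z\<in>K. z \<noteq> s \<and> E z y \<and> \<not> E z s \<and> \<not> E s z)"
    using min_in_degree_vertex[OF \<open>finite K\<close> False irrefl acyclic] by blast
  with clique have "\<forall>v\<in>K. v = s \<or> E s v" by blast
  with \<open>s \<in> K\<close> that show ?thesis by blast
qed

text \<open>The three vertices are \<open>x\<close> of minimum in-degree, \<open>s\<close> dominating the non-neighbours of \<open>x\<close>, and
  \<open>t\<close> dominating the set \<open>R\<close> left over, which lies inside the clique of non-neighbours of \<open>s\<close>. The
  arc relation \<open>E\<close> may contain pairs of opposite arcs.\<close>

lemma three_vertices_dominate: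
  assumes "finite V" "V \<noteq> {}"
    and irrefl: "\<forall>v\<in>V. \<not> E v v"
    and acyclic: "\<forall>u\<in>V. \<forall>v\<in>V. \<forall>w\<in>V. E u v \<longrightarrow> E v w \<longrightarrow> \<not> E w u"
    and alpha: "\<forall>a\<in>V. \<forall>b\<in>V. \<forall>c\<in>V. a \<noteq> b \<and> a \<noteq> c \<and> b \<noteq> c \<and>
      \<not> E a b \<and> \<not> E b a \<and> \<not> E a c \<and> \<not> E c a \<longrightarrow> E b c \<or> E c b"
  obtains U where "U \<subseteq> V" "card U \<le> 3" "\<forall>v\<in>V - U. \<exists>u\<in>U. E u v"
proof -
  define Non where "Non v = {u \<in> V. u \<noteq> v \<and> \<not> E u v \<and> \<not> E v u}" for v
  have dominate_clique: "\<exists>s. (K \<noteq> {} \<longrightarrow> s \<in> K) \<and> (\<forall>v\<in>K. v = s \<or> E s v)"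
    if K: "K \<subseteq> Non a" and a: "a \<in> V" for K a
  proof -
    have "K \<subseteq> V" using K by (auto simp: Non_def)
    then have "finite K" using \<open>finite V\<close> by (rule finite_subset)
    moreover have "\<forall>v\<in>K. \<not> E v v"
      using \<open>K \<subseteq> V\<close> irrefl by blast
    moreover have "\<forall>u\<in>K. \<forall>v\<in>K. \<forall>w\<in>K. E u v \<longrightarrow> E v w \<longrightarrow> \<not> E w u"
      using \<open>K \<subseteq> V\<close> acyclic by blast
    moreover have "\<forall>u\<in>K. \<forall>v\<in>K. u \<noteq> v \<longrightarrow> E u v \<or> E v u"
    proof (intro ballI impI)
      fix u v assume "u \<in> K" "v \<in> K" "u \<noteq> v"
      with K have "u \<in> Non a" "v \<in> Non a" by blast+
      with a \<open>u \<noteq> v\<close> alpha[rule_format, of a u v] show "E u v \<or> E v u"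
        by (auto simp: Non_def)
    qed
    ultimately show ?thesis
      by (rule clique_dominated_by_vertex) blast
  qed

  obtain x where x: "x \<in> V"
    and x_min: "\<forall>y\<in>V. E y x \<longrightarrow> \<not> E x y \<longrightarrow> (\<exists>z\<in>V. z \<noteq> x \<and> E z y \<and> \<not> E z x \<and> \<not> E x z)"
    using min_in_degree_vertex[OF \<open>finite V\<close> \<open>V \<noteq> {}\<close> irrefl acyclic] by blast
  have via_Non: "\<exists>z\<in>Non x. E z y" if "y \<in> V" "E y x" "\<not> E x y" for y
    using x_min[rule_format, OF that] by (auto simp: Non_def)
  obtain s where s: "Non x \<noteq> {} \<longrightarrow> s \<in> Non x" "\<forall>v\<in>Non x. v = s \<or> E s v"
    using dominate_clique[OF subset_refl x] by blast
  show ?thesis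
  proof (cases "Non x = {}")
    case True
    with via_Non have "\<forall>v\<in>V - {x}. E x v" by (auto simp: Non_def)
    with x that[of "{x}"] show ?thesis by simp
  next
    case False
    with s have sV: "s \<in> V" by (auto simp: Non_def)
    define R where "R = {y \<in> V. y \<noteq> x \<and> y \<noteq> s \<and> \<not> E x y \<and> \<not> E s y}"
    have "R \<subseteq> Non s"
    proof
      fix y assume "y \<in> R"
      then have y: "y \<in> V" "y \<noteq> x" "y \<noteq> s" "\<not> E x y" "\<not> E s y" by (auto simp: R_def)
      with s(2) have "E y x" by (auto simp: Non_def)
      with via_Non y obtain z where z: "z \<in> Non x" "E z y" by blast
      with y have "z \<noteq> s" by auto
      with s(2) z have "E s z" by blast
      moreover from z have "z \<in> V" by (simp add: Non_def)
      ultimately have "\<not> E y s" using z y sV acyclic by blast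
      with y show "y \<in> Non s" by (simp add: Non_def)
    qed
    from dominate_clique[OF this sV] obtain t
      where t: "R \<noteq> {} \<longrightarrow> t \<in> R" "\<forall>v\<in>R. v = t \<or> E t v" by blast
    \<comment> \<open>Intersecting with \<open>V\<close> discards the arbitrary \<open>t\<close> of the case \<open>R = {}\<close>.\<close>
    define U where "U = {x, s, t} \<inter> V"
    have "card U \<le> card {x, s, t}" unfolding U_def by (intro card_mono) auto
    also have "\<dots> \<le> 3" by (simp add: card_insert_if)
    finally have "card U \<le> 3" .
    moreover have "\<forall>v\<in>V - U. \<exists>u\<in>U. E u v"
    proof
      fix v assume v: "v \<in> V - U"
      show "\<exists>u\<in>U. E u v"
      proof (cases "v \<in> R")
        case True
        with t have "t \<in> U" by (auto simp: U_def R_def)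
        with v have "v \<noteq> t" by auto
        with True t have "E t v" by blast
        with \<open>t \<in> U\<close> show ?thesis by blast
      next
        case False
        with v x sV show ?thesis by (auto simp: U_def R_def)
      qed
    qed
    moreover have "U \<subseteq> V" by (simp add: U_def)
    ultimately show ?thesis using that by blast
  qed
qed

theorem theorem4:
  fixes D :: "('a, 'b) pre_digraph"
  assumes "digraph D"
    and "clique_acyclic D"
    and "independence_number D = 2"
  shows "domination_number D \<le> 3"
proof -
  interpret digraph D by fact
  have "\<exists>U. dominating_set D U \<and> card U \<le> 3"
  proof (cases "verts D = {}")
    case True
    then have "dominating_set D {}" by (simp add: dominating_set_def)
    then show ?thesis by (intro exI[of _ "{}"]) simp
  next
    case False
    have irrefl: "\<not> v \<rightarrow>\<^bsub>D\<^esub> v" for v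
      using adj_not_same by blast
    have independent_le_2: "card S \<le> 2" if "independent_set D S" for S
    proof -
      have "finite {card S | S. independent_set D S}"
        by (rule finite_subset[of _ "card ` Pow (verts D)"]) (auto simp: independent_set_def)
      then have "card S \<le> independence_number D"
        unfolding independence_number_def using that by (intro Max_ge) auto
      with \<open>independence_number D = 2\<close> show ?thesis by simp
    qed
    have alpha: "\<forall>a\<in>verts D. \<forall>b\<in>verts D. \<forall>c\<in>verts D. a \<noteq> b \<and> a \<noteq> c \<and> b \<noteq> c \<and>
      \<not> a \<rightarrow>\<^bsub>D\<^esub> b \<and> \<not> b \<rightarrow>\<^bsub>D\<^esub> a \<and> \<not> a \<rightarrow>\<^bsub>D\<^esub> c \<and> \<not> c \<rightarrow>\<^bsub>D\<^esub> a \<longrightarrow>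
      b \<rightarrow>\<^bsub>D\<^esub> c \<or> c \<rightarrow>\<^bsub>D\<^esub> b"
    proof (intro ballI impI, elim conjE, rule ccontr)
      fix a b c
      assume "a \<in> verts D" "b \<in> verts D" "c \<in> verts D"
        and distinct: "a \<noteq> b" "a \<noteq> c" "b \<noteq> c"
        and "\<not> a \<rightarrow>\<^bsub>D\<^esub> b" "\<not> b \<rightarrow>\<^bsub>D\<^esub> a" "\<not> a \<rightarrow>\<^bsub>D\<^esub> c" "\<not> c \<rightarrow>\<^bsub>D\<^esub> a"
          "\<not> (b \<rightarrow>\<^bsub>D\<^esub> c \<or> c \<rightarrow>\<^bsub>D\<^esub> b)"
      with irrefl have "independent_set D {a, b, c}"
        by (auto simp: independent_set_def)
      from independent_le_2[OF this] distinct show False by simp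
    qed
    have acyclic: "\<forall>u\<in>verts D. \<forall>v\<in>verts D. \<forall>w\<in>verts D.
      u \<rightarrow>\<^bsub>D\<^esub> v \<longrightarrow> v \<rightarrow>\<^bsub>D\<^esub> w \<longrightarrow> \<not> w \<rightarrow>\<^bsub>D\<^esub> u"
      using \<open>clique_acyclic D\<close> unfolding clique_acyclic_def by blast
    have "\<forall>v\<in>verts D. \<not> v \<rightarrow>\<^bsub>D\<^esub> v" using irrefl by blast
    from three_vertices_dominate[of "verts D" "\<lambda>u v. u \<rightarrow>\<^bsub>D\<^esub> v",
      OF finite_verts False this acyclic alpha]
    obtain U where "U \<subseteq> verts D" "card U \<le> 3" "\<forall>v\<in>verts D - U. \<exists>u\<in>U. u \<rightarrow>\<^bsub>D\<^esub> v"
      by blast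
    then have "dominating_set D U" by (simp add: dominating_set_def)
    with \<open>card U \<le> 3\<close> show ?thesis by blast
  qed
  then obtain U where U: "dominating_set D U" "card U \<le> 3" by blast
  have "finite {card U | U. dominating_set D U}"
    by (rule finite_subset[of _ "card ` Pow (verts D)"]) (auto simp: dominating_set_def)
  then have "domination_number D \<le> card U"
    unfolding domination_number_def using U(1) by (intro Min_le) auto
  with U(2) show ?thesis by simp
qed

end
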